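(* Let $\mathcal M$ be a computational model in which $(G,\mathsf{init})$ is interpreted as a cryptographic pseudo-random number generator (CPRNG). Then for every $n\ge0$ and all pairwise distinct names $\mathsf n_0,\dots,\mathsf n_n$ and every name $\mathsf n$, $$\mathcal M\models\ \pi_o(s_0),\dots,\pi_o(s_n)\ \sim\ \mathsf n_0,\dots,\mathsf n_n,$$ where $s_0\equiv G(\mathsf{init}(\mathsf n))$ and $s_{i+1}\equiv G(\pi_S(s_i))$ for $0\le i<n$.
   Context: Terms are built from names and function symbols, including $G$ (maps an internal state to a pair consisting of the new internal state and the generated number), $\pi_S,\pi_o$ (projections of such a pair on the new state and on the output; outputs are $\eta$-bit strings, of the same sort $\mathsf{Nonce}$ as names), and $\mathsf{init}$ (maps a seed to an initial state). In a computational model, for security parameter $\eta$ and infinite uniform random tapes $\rho_1$ (honest) and $\rho_2$ (attacker), names are interpreted as $\eta$-bit blocks of $\rho_1$, distinct names using disjoint blocks; function symbols are interpreted as deterministic polynomial-time functions (of $1^\eta$ and the argument values). $\mathcal M\models\vec u\sim\vec v$ iff for every deterministic polynomial-time $\mathcal A$, $|\Pr_{\rho_1,\rho_2}(\mathcal A([\![\vec u]\!],1^\eta,\rho_2)=1)-\Pr_{\rho_1,\rho_2}(\mathcal A([\![\vec v]\!],1^\eta,\rho_2)=1)|$ is negligible in $\eta$. CPRNG. A pair of polynomial-time functions $(G,\mathsf{init})$ is a CPRNG if for every probabilistic polynomial-time $\mathcal A$ and every $n$, $|\Pr_{r}(\mathcal A(\pi_o(s_0),\dots,\pi_o(s_n))=1)-\Pr_{r_0,\dots,r_n}(\mathcal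 A(r_0,\dots,r_n)=1)|$ is negligible in $\eta$, where $r,r_0,\dots,r_n$ are independent uniform in $\{0,1\}^\eta$, $s_0=G(\mathsf{init}(r,1^\eta))$ and $s_{i+1}=G(\pi_S(s_i))$ for $0\le i<n$; the term $\mathsf{init}(\mathsf n)$ is interpreted as $\mathsf{init}([\![\mathsf n]\!],1^\eta)$. *)

theory Defs
  imports
    "HOL-Probability.Probability"
    "HOL-Computational_Algebra.Polynomial"
begin

section \<open>Deterministic multi-tape Turing machines\<close>

type_synonym bits = "bool list"

datatype symbol = Blank | Start | Sep | Bit bool | Aux nat

datatype move = MoveLeft | Stay | MoveRight

text \<open>
  The states are the numbers up to \<open>num_states\<close>; \<open>0\<close> is initial and
  \<open>num_states\<close> is the halting state. Each machine has finitely many symbols \<open>Aux k\<close>.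
\<close>

record machine =
  num_tapes :: nat
  num_states :: nat
  num_aux :: nat
  trans :: "nat \<Rightarrow> symbol list \<Rightarrow> nat \<times> (symbol \<times> move) list"

definition alphabet :: "machine \<Rightarrow> symbol set" where
  "alphabet T = {Blank, Start, Sep} \<union> range Bit \<union> Aux ` {..<num_aux T}"

definition wf_machine :: "machine \<Rightarrow> bool" where
  "wf_machine T \<longleftrightarrow> num_tapes T \<ge> 3 \<and>
     (\<forall>q ss. q < num_states T \<longrightarrow> length ss = num_tapes T \<longrightarrow> set ss \<subseteq> alphabet T \<longrightarrow>
        fst (trans T q ss) \<le> num_states T \<and>
        length (snd (trans T q ss)) = num_tapes T \<and>
        fst ` set (snd (trans T q ss)) \<subseteq> alphabet T)"

text \<open>
  A tape is infinite to the right and is given by its contents and its head position.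
  A head at position \<open>0\<close> stays there on \<open>MoveLeft\<close>, by subtraction on naturals.
\<close>

type_synonym tape = "(nat \<Rightarrow> symbol) \<times> nat"
type_synonym config = "nat \<times> tape list"

fun move_head :: "move \<Rightarrow> nat \<Rightarrow> nat" where
  "move_head MoveLeft h = h - 1"
| "move_head Stay h = h"
| "move_head MoveRight h = h + 1"

fun act :: "symbol \<times> move \<Rightarrow> tape \<Rightarrow> tape" where
  "act (s, m) (c, h) = (c(h := s), move_head m h)"

definition step :: "machine \<Rightarrow> config \<Rightarrow> config" where
  "step T cfg =
     (if fst cfg < num_states T
      then let (q, acts) = trans T (fst cfg) (map (\<lambda>(c, h). c h) (snd cfg))
           in (q, map2 act acts (snd cfg))
      else cfg)"

definition halted :: "machine \<Rightarrow> config \<Rightarrow> bool" where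
  "halted T cfg \<longleftrightarrow> fst cfg = num_states T"

definition mk_tape :: "(nat \<Rightarrow> symbol) \<Rightarrow> tape" where
  "mk_tape w = ((\<lambda>i. case i of 0 \<Rightarrow> Start | Suc j \<Rightarrow> w j), 0)"

text \<open>The input of a machine consists of \<open>1\<^sup>\<eta>\<close> and a list of bitstrings.\<close>

definition input_word :: "nat \<Rightarrow> bits list \<Rightarrow> symbol list" where
  "input_word \<eta> xs = concat (map (\<lambda>x. map Bit x @ [Sep]) (replicate \<eta> True # xs))"

text \<open>
  Tape \<open>0\<close> holds the input, tape \<open>1\<close> the random tape (blank for deterministic
  functions), tape \<open>2\<close> the output; the remaining tapes are work tapes.
\<close>

definition init_config :: "machine \<Rightarrow> (nat \<Rightarrow> symbol) \<Rightarrow> nat \<Rightarrow> bits list \<Rightarrow> config" where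
  "init_config T rnd \<eta> xs =
     (0, mk_tape (\<lambda>i. if i < length (input_word \<eta> xs) then input_word \<eta> xs ! i else Blank)
         # mk_tape rnd # replicate (num_tapes T - 2) (mk_tape (\<lambda>_. Blank)))"

definition run :: "machine \<Rightarrow> (nat \<Rightarrow> symbol) \<Rightarrow> nat \<Rightarrow> bits list \<Rightarrow> nat \<Rightarrow> config" where
  "run T rnd \<eta> xs t = (step T ^^ t) (init_config T rnd \<eta> xs)"

definition outputs :: "config \<Rightarrow> bits \<Rightarrow> bool" where
  "outputs cfg y \<longleftrightarrow>
     (let c = fst (snd cfg ! 2) in
        (\<forall>i<length y. c (Suc i) = Bit (y ! i)) \<and> c (Suc (length y)) = Blank)"


section \<open>Polynomial time, negligibility, random tapes\<close>

text \<open>Polynomial-time functions of \<open>1\<^sup>\<eta>\<close> and \<open>k\<close> bitstrings.\<close>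

definition polytime_fun :: "nat \<Rightarrow> (nat \<Rightarrow> bits list \<Rightarrow> bits) \<Rightarrow> bool" where
  "polytime_fun k f \<longleftrightarrow>
     (\<exists>T (p :: nat poly). wf_machine T \<and>
        (\<forall>\<eta> xs. length xs = k \<longrightarrow>
           (let cfg = run T (\<lambda>_. Blank) \<eta> xs (poly p (length (input_word \<eta> xs)))
            in halted T cfg \<and> outputs cfg (f \<eta> xs))))"

text \<open>
  Polynomial-time adversaries with \<open>k\<close> inputs. The running time is bounded in the length of
  the inputs and \<open>1\<^sup>\<eta>\<close>, uniformly in the contents of the infinite random tape.
\<close>

definition polytime_adversary :: "nat \<Rightarrow> machine \<Rightarrow> bool" where
  "polytime_adversary k A \<longleftrightarrow> wf_machine A \<and>
     (\<exists>p :: nat poly. \<forall>\<eta> xs \<rho>. length xs = k \<longrightarrow>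
        halted A (run A (\<lambda>i. Bit (\<rho> i)) \<eta> xs (poly p (length (input_word \<eta> xs)))))"

text \<open>\<open>A(xs, 1\<^sup>\<eta>, \<rho>) = 1\<close>\<close>

definition accepts :: "machine \<Rightarrow> nat \<Rightarrow> bits list \<Rightarrow> (nat \<Rightarrow> bool) \<Rightarrow> bool" where
  "accepts A \<eta> xs \<rho> \<longleftrightarrow>
     (\<exists>t. halted A (run A (\<lambda>i. Bit (\<rho> i)) \<eta> xs t) \<and>
          outputs (run A (\<lambda>i. Bit (\<rho> i)) \<eta> xs t) [True])"

definition negligible :: "(nat \<Rightarrow> real) \<Rightarrow> bool" where
  "negligible f \<longleftrightarrow> (\<forall>c::nat. \<forall>\<^sub>F \<eta> in sequentially. \<bar>f \<eta>\<bar> < 1 / real \<eta> ^ c)"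

definition coin_tape :: "(nat \<Rightarrow> bool) measure" where
  "coin_tape = (\<Pi>\<^sub>M i\<in>UNIV. measure_pmf (pmf_of_set (UNIV :: bool set)))"

definition uniform_bits :: "nat \<Rightarrow> bits pmf" where
  "uniform_bits \<eta> = pmf_of_set {x. length x = \<eta>}"


section \<open>Cryptographic pseudo-random number generators\<close>

type_synonym interp = "nat \<Rightarrow> bits list \<Rightarrow> bits"

primrec prng_state :: "interp \<Rightarrow> interp \<Rightarrow> interp \<Rightarrow> nat \<Rightarrow> bits \<Rightarrow> nat \<Rightarrow> bits" where
  "prng_state \<pi>\<^sub>S G ini \<eta> r 0 = G \<eta> [ini \<eta> [r]]"
| "prng_state \<pi>\<^sub>S G ini \<eta> r (Suc i) = G \<eta> [\<pi>\<^sub>S \<eta> [prng_state \<pi>\<^sub>S G ini \<eta> r i]]"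

definition cprng :: "interp \<Rightarrow> interp \<Rightarrow> interp \<Rightarrow> interp \<Rightarrow> bool" where
  "cprng \<pi>\<^sub>S \<pi>\<^sub>o G ini \<longleftrightarrow> polytime_fun 1 G \<and> polytime_fun 1 ini \<and>
     (\<forall>n A. polytime_adversary (Suc n) A \<longrightarrow>
        negligible (\<lambda>\<eta>. \<bar>
          \<P>((r, \<rho>) in measure_pmf (uniform_bits \<eta>) \<Otimes>\<^sub>M coin_tape.
             accepts A \<eta> (map (\<lambda>i. \<pi>\<^sub>o \<eta> [prng_state \<pi>\<^sub>S G ini \<eta> r i]) [0..<Suc n]) \<rho>)
        - \<P>((rs, \<rho>) in measure_pmf (replicate_pmf (Suc n) (uniform_bits \<eta>)) \<Otimes>\<^sub>M coin_tape.
             accepts A \<eta> rs \<rho>)\<bar>))"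


section \<open>Terms\<close>

text \<open>
  \<open>StateOut\<close> is the sort of pairs of a state and a generated number. There may be further
  sorts \<open>'s\<close> and function symbols \<open>'f\<close>, the latter typed by a signature.
\<close>

datatype 's sort = Nonce | State | StateOut | OtherSort 's

datatype 'f fsym = Gen | ProjS | ProjO | Init | OtherFun 'f

type_synonym ('f, 's) signature = "'f \<Rightarrow> 's sort list \<times> 's sort"

fun fsym_type :: "('f, 's) signature \<Rightarrow> 'f fsym \<Rightarrow> 's sort list \<times> 's sort" where
  "fsym_type \<Sigma> Gen = ([State], StateOut)"
| "fsym_type \<Sigma> ProjS = ([StateOut], State)"
| "fsym_type \<Sigma> ProjO = ([StateOut], Nonce)"
| "fsym_type \<Sigma> Init = ([Nonce], State)"
| "fsym_type \<Sigma> (OtherFun f) = \<Sigma> f"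

datatype ('n, 'f) trm = Name 'n | App "'f fsym" "('n, 'f) trm list"

inductive has_sort :: "('f, 's) signature \<Rightarrow> ('n, 'f) trm \<Rightarrow> 's sort \<Rightarrow> bool"
  for \<Sigma> :: "('f, 's) signature" where
  "has_sort \<Sigma> (Name n) Nonce"
| "fsym_type \<Sigma> f = (ss, s) \<Longrightarrow> list_all2 (has_sort \<Sigma>) ts ss \<Longrightarrow> has_sort \<Sigma> (App f ts) s"

primrec prng_term :: "'n \<Rightarrow> nat \<Rightarrow> ('n, 'f) trm" where
  "prng_term n 0 = App Gen [App Init [Name n]]"
| "prng_term n (Suc i) = App Gen [App ProjS [prng_term n i]]"

lemma has_sort_prng_term: "has_sort \<Sigma> (prng_term n i) StateOut"
  by (induction i) (auto intro!: has_sort.intros)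

lemma has_sort_prng_output: "has_sort \<Sigma> (App ProjO [prng_term n i]) Nonce"
  by (auto intro!: has_sort.intros has_sort_prng_term)


section \<open>Computational models\<close>

text \<open>
  All values are bitstrings. For each \<open>\<eta>\<close>, \<open>pair\<close> is the encoding of pairs of a
  state and a generated number, and the block of the honest tape assigned to a name
  consists of the \<open>\<eta>\<close> bits starting at \<open>name_pos\<close>.
\<close>

record ('n, 'f, 's) model =
  sort_dom :: "nat \<Rightarrow> 's sort \<Rightarrow> bits set"
  pair :: "nat \<Rightarrow> bits \<Rightarrow> bits \<Rightarrow> bits"
  fun_int :: "'f fsym \<Rightarrow> interp"
  name_pos :: "nat \<Rightarrow> 'n \<Rightarrow> nat"

definition name_block :: "('n, 'f, 's) model \<Rightarrow> nat \<Rightarrow> 'n \<Rightarrow> nat set" where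
  "name_block M \<eta> n = {name_pos M \<eta> n..<name_pos M \<eta> n + \<eta>}"

definition computational_model :: "('f, 's) signature \<Rightarrow> ('n, 'f, 's) model \<Rightarrow> bool" where
  "computational_model \<Sigma> M \<longleftrightarrow>
     (\<forall>\<eta>. sort_dom M \<eta> Nonce = {x. length x = \<eta>}) \<and>
     (\<forall>\<eta>. sort_dom M \<eta> StateOut =
            {pair M \<eta> x y | x y. x \<in> sort_dom M \<eta> State \<and> y \<in> sort_dom M \<eta> Nonce}) \<and>
     (\<forall>\<eta>. \<forall>x\<in>sort_dom M \<eta> State. \<forall>y\<in>sort_dom M \<eta> Nonce.
            fun_int M ProjS \<eta> [pair M \<eta> x y] = x \<and> fun_int M ProjO \<eta> [pair M \<eta> x y] = y) \<and>
     (\<forall>f ss s. fsym_type \<Sigma> f = (ss, s) \<longrightarrow>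
        polytime_fun (length ss) (fun_int M f) \<and>
        (\<forall>\<eta> xs. list_all2 (\<lambda>x s'. x \<in> sort_dom M \<eta> s') xs ss \<longrightarrow>
           fun_int M f \<eta> xs \<in> sort_dom M \<eta> s)) \<and>
     (\<forall>\<eta> n n'. n \<noteq> n' \<longrightarrow> name_block M \<eta> n \<inter> name_block M \<eta> n' = {})"

fun eval_term :: "('n, 'f, 's) model \<Rightarrow> nat \<Rightarrow> (nat \<Rightarrow> bool) \<Rightarrow> ('n, 'f) trm \<Rightarrow> bits" where
  "eval_term M \<eta> \<rho> (Name n) = map \<rho> [name_pos M \<eta> n..<name_pos M \<eta> n + \<eta>]"
| "eval_term M \<eta> \<rho> (App f ts) = fun_int M f \<eta> (map (eval_term M \<eta> \<rho>) ts)"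

lemma eval_term_sort_dom:
  assumes "computational_model \<Sigma> M" and "has_sort \<Sigma> t s"
  shows "eval_term M \<eta> \<rho> t \<in> sort_dom M \<eta> s"
  using assms(2)
proof (induction rule: has_sort.induct)
  case (1 n)
  then show ?case using assms(1) by (simp add: computational_model_def)
next
  case (2 f ss s ts)
  have "list_all2 (\<lambda>x s'. x \<in> sort_dom M \<eta> s') (map (eval_term M \<eta> \<rho>) ts) ss"
    using 2(2) by (auto simp: list_all2_conv_all_nth)
  then show ?case using assms(1) 2(1) by (simp add: computational_model_def)
qed

definition adv_prob ::
    "('n, 'f, 's) model \<Rightarrow> machine \<Rightarrow> nat \<Rightarrow> ('n, 'f) trm list \<Rightarrow> real" where
  "adv_prob M A \<eta> us =
     \<P>((\<rho>\<^sub>1, \<rho>\<^sub>2) in coin_tape \<Otimes>\<^sub>M coin_tape. accepts A \<eta> (map (eval_term M \<eta> \<rho>\<^sub>1) us) \<rho>\<^sub>2)"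

definition indist ::
    "('n, 'f, 's) model \<Rightarrow> ('n, 'f) trm list \<Rightarrow> ('n, 'f) trm list \<Rightarrow> bool"
    (\<open>(_ \<Turnstile>/ _ \<sim>/ _)\<close> [51, 51, 51] 50) where
  "M \<Turnstile> us \<sim> vs \<longleftrightarrow> length us = length vs \<and>
     (\<forall>A. polytime_adversary (length us) A \<longrightarrow>
        negligible (\<lambda>\<eta>. \<bar>adv_prob M A \<eta> us - adv_prob M A \<eta> vs\<bar>))"

end

theory Submission
  imports Defs
begin

text \<open>
  In a computational model the block of a name is a uniform bitstring, and the blocks of
  distinct names are independent. So for every adversary and every \<open>\<eta>\<close> the two acceptance
  probabilities of the indistinguishability game are equal to those of the CPRNG game. The
  probability of a non-measurable event would be the junk value \<open>0\<close>, so transporting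
  probabilities along the block map needs acceptance to be measurable. It is, because after \<open>t\<close>
  steps a machine has read only the first \<open>t\<close> cells of its random tape.
\<close>

section \<open>Acceptance is measurable in the random tape\<close>

text \<open>\<open>N\<close> is a fixed window of compared cells, \<open>s\<close> a step counter
  that bounds the head. A head starts at cell 0 and moves at most one cell per step, so it stays in
  the window while \<open>s\<close> \<le> \<open>N\<close>.\<close>

definition agree_upto :: "nat \<Rightarrow> nat \<Rightarrow> tape \<Rightarrow> tape \<Rightarrow> bool" where
  "agree_upto N s tp tp' \<longleftrightarrow>
     snd tp = snd tp' \<and> snd tp \<le> s \<and> (\<forall>i\<le>N. fst tp i = fst tp' i)"

lemma agree_upto_act:
  assumes "agree_upto N s tp tp'"
  shows "agree_upto N (Suc s) (act a tp) (act a tp')"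
proof -
  obtain b mv where a: "a = (b, mv)" by (cases a)
  show ?thesis
    using assms unfolding a by (cases mv; cases tp; cases tp') (auto simp: agree_upto_def)
qed

lemma agree_upto_step:
  assumes "fst cfg = fst cfg'" and "list_all2 (agree_upto N s) (snd cfg) (snd cfg')" and "s \<le> N"
  shows "fst (step T cfg) = fst (step T cfg') \<and>
         list_all2 (agree_upto N (Suc s)) (snd (step T cfg)) (snd (step T cfg'))"
proof -
  have reads: "map (\<lambda>(c, h). c h) (snd cfg) = map (\<lambda>(c, h). c h) (snd cfg')"
    using assms(2,3)
    by (auto simp: list_all2_conv_all_nth agree_upto_def split_beta intro!: nth_equalityI)
  have acts: "list_all2 (agree_upto N (Suc s)) (map2 act as (snd cfg)) (map2 act as (snd cfg'))" for as
    using assms(2) by (auto simp: list_all2_conv_all_nth intro!: agree_upto_act)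
  \<comment> \<open>This serves a halted configuration: it stays as it is, and the head bound is
    only weakened.\<close>
  have "list_all2 (agree_upto N (Suc s)) (snd cfg) (snd cfg')"
    using assms(2) by (rule list_all2_mono) (auto simp: agree_upto_def)
  then show ?thesis
    using acts assms(1) reads by (simp add: step_def Let_def split_beta)
qed

lemma agree_upto_run:
  assumes "\<And>i. i < N \<Longrightarrow> rnd i = rnd' i" and "t \<le> N"
  shows "fst (run T rnd \<eta> xs t) = fst (run T rnd' \<eta> xs t) \<and>
         list_all2 (agree_upto N t) (snd (run T rnd \<eta> xs t)) (snd (run T rnd' \<eta> xs t))"
  using assms(2)
proof (induction t)
  case 0
  have "agree_upto N 0 tp tp" if "snd tp = 0" for tp
    using that by (simp add: agree_upto_def)
  \<comment> \<open>Cell 0 holds \<open>Start\<close>, so the first \<open>N\<close> random symbols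
    fill cells 1 to \<open>N\<close>; hence \<open>i < N\<close> in the hypothesis but cells up to
    and including \<open>N\<close> in the window.\<close>
  moreover have "agree_upto N 0 (mk_tape rnd) (mk_tape rnd')"
    using assms(1) by (auto simp: agree_upto_def mk_tape_def split: nat.splits)
  ultimately show ?case
    by (simp add: run_def init_config_def list_all2_conv_all_nth nth_Cons mk_tape_def split: nat.splits)
next
  case (Suc t)
  then show ?case
    using agree_upto_step[of "run T rnd \<eta> xs t" "run T rnd' \<eta> xs t" N t T] by (simp add: run_def)
qed

text \<open>The test for output \<open>y\<close> inspects cells 1 to \<open>Suc (length y)\<close>
  of tape 2, the last one for the terminating blank.\<close>

lemma outputs_agree_upto:
  assumes "list_all2 (agree_upto N s) (snd cfg) (snd cfg')" and "Suc (length y) \<le> N"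
  shows "outputs cfg y \<longleftrightarrow> outputs cfg' y"
proof -
  have "fst (snd cfg ! 2) i = fst (snd cfg' ! 2) i" if "i \<le> N" for i
  proof (cases "2 < length (snd cfg)")
    case True
    then show ?thesis
      using assms(1) that by (auto simp: list_all2_conv_all_nth agree_upto_def)
  next
    case False
    \<comment> \<open>An out-of-range \<open>nth\<close> depends only on the index and the length of the list.\<close>
    then show ?thesis
      using list_all2_lengthD[OF assms(1)]
        nth_append[of "snd cfg" "[]" 2] nth_append[of "snd cfg'" "[]" 2] by simp
  qed
  then show ?thesis
    using assms(2) by (auto simp: outputs_def Let_def)
qed

lemma space_coin_tape [simp]: "space coin_tape = UNIV"
  by (simp add: coin_tape_def space_PiM)

lemma prob_space_coin_tape: "prob_space coin_tape"
  unfolding coin_tape_def by (rule prob_space_PiM) (rule prob_space_measure_pmf)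

lemma measurable_coin_tape_nth: "(\<lambda>\<rho>. \<rho> i) \<in> measurable coin_tape (count_space UNIV)"
  unfolding coin_tape_def
  using measurable_component_singleton[of i UNIV "\<lambda>_. measure_pmf (pmf_of_set (UNIV :: bool set))"]
  by simp

lemma measurable_coin_tape_map:
  "(\<lambda>\<rho>. map \<rho> ps) \<in> measurable coin_tape (count_space UNIV)"
proof (induction ps)
  case (Cons p ps)
  note measurable_coin_tape_nth[measurable] Cons[measurable]
  show ?case by simp
qed simp

lemma measurable_coin_tape_map_map:
  "(\<lambda>\<rho>. map (map \<rho>) pss) \<in> measurable coin_tape (count_space UNIV)"
proof (induction pss)
  case (Cons ps pss)
  note measurable_coin_tape_map[measurable] Cons[measurable]
  show ?case by simp
qed simp

lemma measurable_coin_tape_prefix: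
  assumes "\<And>\<rho> \<rho>'. (\<And>i. i < N \<Longrightarrow> \<rho> i = \<rho>' i) \<Longrightarrow> P \<rho> \<longleftrightarrow> P \<rho>'"
  shows "Measurable.pred coin_tape P"
proof -
  \<comment> \<open>The predicate factors through a finite prefix, a map into a discrete space.
    Beyond the prefix \<open>l ! i\<close> is an unspecified bit, which \<open>P\<close>
    ignores.\<close>
  have "P \<rho> \<longleftrightarrow> (\<lambda>l. P (\<lambda>i. l ! i)) (map \<rho> [0..<N])" for \<rho>
    by (rule assms) simp
  then have eq: "P = (\<lambda>l. P (\<lambda>i. l ! i)) \<circ> (\<lambda>\<rho>. map \<rho> [0..<N])"
    by (auto simp: fun_eq_iff)
  show ?thesis
    by (subst eq, rule measurable_comp[OF measurable_coin_tape_map]) simp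
qed

lemma measurable_accepts: "Measurable.pred coin_tape (accepts A \<eta> xs)"
proof -
  have "Measurable.pred coin_tape (\<lambda>\<rho>. halted A (run A (\<lambda>i. Bit (\<rho> i)) \<eta> xs t) \<and>
          outputs (run A (\<lambda>i. Bit (\<rho> i)) \<eta> xs t) [True])" for t
  \<comment> \<open>The window must contain the \<open>t\<close> steps of the run and cell 2, where
    the output \<open>[True]\<close> needs a blank. Acceptance is then a countable union over
    \<open>t\<close>.\<close>
  proof (rule measurable_coin_tape_prefix[where N = "t + 2"])
    fix \<rho> \<rho>' :: "nat \<Rightarrow> bool"
    assume "\<And>i. i < t + 2 \<Longrightarrow> \<rho> i = \<rho>' i"
    then have "fst (run A (\<lambda>i. Bit (\<rho> i)) \<eta> xs t) = fst (run A (\<lambda>i. Bit (\<rho>' i)) \<eta> xs t) \<and>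
         list_all2 (agree_upto (t + 2) t)
           (snd (run A (\<lambda>i. Bit (\<rho> i)) \<eta> xs t)) (snd (run A (\<lambda>i. Bit (\<rho>' i)) \<eta> xs t))"
      by (intro agree_upto_run) auto
    then show "(halted A (run A (\<lambda>i. Bit (\<rho> i)) \<eta> xs t) \<and>
          outputs (run A (\<lambda>i. Bit (\<rho> i)) \<eta> xs t) [True]) \<longleftrightarrow>
        (halted A (run A (\<lambda>i. Bit (\<rho>' i)) \<eta> xs t) \<and>
          outputs (run A (\<lambda>i. Bit (\<rho>' i)) \<eta> xs t) [True])"
      using outputs_agree_upto[of "t + 2" t "run A (\<lambda>i. Bit (\<rho> i)) \<eta> xs t"
          "run A (\<lambda>i. Bit (\<rho>' i)) \<eta> xs t" "[True]"]
      by (simp add: halted_def)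
  qed
  then show ?thesis
    unfolding accepts_def[abs_def] by measurable
qed

section \<open>Blocks of the honest tape are independent uniform bitstrings\<close>

lemma emeasure_coin_tape_map:
  assumes "distinct ps"
  shows "emeasure coin_tape {\<rho>. map \<rho> ps = l} =
    ennreal (if length l = length ps then (1 / 2) ^ length ps else 0)"
proof (cases "length l = length ps")
  case True
  interpret product_prob_space "\<lambda>_. measure_pmf (pmf_of_set (UNIV :: bool set))" "UNIV :: nat set"
    by unfold_locales
  \<comment> \<open>The bit prescribed at each position, well defined since \<open>ps\<close> is
    distinct. It turns the event into a cylinder, whose measure is a product.\<close>
  define f where "f = the \<circ> map_of (zip ps l)"
  have f: "map f ps = l"
    using True assms by (intro nth_equalityI) (auto simp: f_def map_of_zip_nth)
  have "{\<rho>. map \<rho> ps = l} = {\<rho> \<in> space coin_tape. \<forall>i\<in>set ps. \<rho> i \<in> {f i}}"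
    by (auto simp flip: f)
  also have "emeasure coin_tape \<dots> =
      (\<Prod>i\<in>set ps. emeasure (measure_pmf (pmf_of_set (UNIV :: bool set))) {f i})"
    unfolding coin_tape_def by (rule emeasure_PiM_Collect) auto
  also have "\<dots> = (\<Prod>i\<in>set ps. ennreal (1 / 2))"
    by (intro prod.cong refl) (simp add: emeasure_pmf_single UNIV_bool)
  also have "\<dots> = ennreal ((1 / 2) ^ length ps)"
    by (simp only: prod_constant distinct_card[OF assms] ennreal_power)
  finally show ?thesis using True by simp
next
  case False
  then have "{\<rho>. map \<rho> ps = l} = {}" by auto
  then show ?thesis using False by simp
qed

lemma pmf_uniform_bits: "pmf (uniform_bits k) x = (if length x = k then (1 / 2) ^ k else 0)"
proof -
  have "{x :: bits. length x = k} = {x. set x \<subseteq> UNIV \<and> length x = k}" by simp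
  then have "finite {x :: bits. length x = k}" "card {x :: bits. length x = k} = 2 ^ k"
    using finite_lists_length_eq[of "UNIV :: bool set" k] card_lists_length_eq[of "UNIV :: bool set" k]
    by simp_all
  moreover have "{x :: bits. length x = k} \<noteq> {}"
    using Ex_list_of_length by blast
  ultimately show ?thesis
    by (simp add: uniform_bits_def pmf_of_set power_one_over)
qed

lemma pmf_replicate_pmf:
  "pmf (replicate_pmf k p) xs = (if length xs = k then prod_list (map (pmf p) xs) else 0)"
proof (induction k arbitrary: xs)
  case 0
  then show ?case by (auto simp: pmf_return)
next
  case (Suc k)
  \<comment> \<open>As the image of a product under the injective cons map, the pmf factors.\<close>
  have *: "replicate_pmf (Suc k) p = map_pmf (\<lambda>(x, xs). x # xs) (pair_pmf p (replicate_pmf k p))"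
    by (simp add: pair_pmf_def map_bind_pmf map_pmf_def bind_assoc_pmf bind_return_pmf)
  show ?case
  proof (cases xs)
    case Nil
    have "xs \<notin> set_pmf (replicate_pmf (Suc k) p)" using Nil by (auto simp: *)
    then show ?thesis using Nil by (simp add: set_pmf_iff del: replicate_pmf.simps)
  next
    case (Cons y ys)
    have "pmf (replicate_pmf (Suc k) p) xs
        = pmf (map_pmf (\<lambda>(x, xs). x # xs) (pair_pmf p (replicate_pmf k p))) ((\<lambda>(x, xs). x # xs) (y, ys))"
      by (simp only: * Cons prod.case)
    also have "\<dots> = pmf p y * pmf (replicate_pmf k p) ys"
      by (subst pmf_map_inj') (auto simp: inj_def pmf_pair)
    finally show ?thesis using Suc.IH Cons by (simp del: replicate_pmf.simps)
  qed
qed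

lemma prod_list_pmf_uniform_bits:
  "prod_list (map (pmf (uniform_bits k)) xs) =
     (if \<forall>x\<in>set xs. length x = k then (1 / 2) ^ (length xs * k) else 0)"
  by (induction xs) (auto simp: pmf_uniform_bits power_add)

text \<open>Once the block lengths are fixed, concatenation loses no information. An event on
  several blocks thus becomes one on a single list of positions, which
  \<open>emeasure_coin_tape_map\<close> measures.\<close>

lemma map_map_eq_iff_map_concat_eq:
  assumes "map length xss = map length pss"
  shows "map (map f) pss = xss \<longleftrightarrow> map f (concat pss) = concat xss"
  using assms
proof (induction pss arbitrary: xss)
  case (Cons ps pss)
  then show ?case by (cases xss) auto
qed simp

text \<open>Lists of bitstrings are countable, so comparing singletons suffices. If the lengths fit,
  both sides give a half to the power \<open>length pss * k\<close>; otherwise both are 0.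
  Distinctness of the concatenation covers repetitions within a block and overlaps between
  blocks.\<close>

lemma distr_coin_tape_blocks:
  assumes "distinct (concat pss)" and "\<And>ps. ps \<in> set pss \<Longrightarrow> length ps = k"
  shows "distr coin_tape (count_space UNIV) (\<lambda>\<rho>. map (map \<rho>) pss) =
         measure_pmf (replicate_pmf (length pss) (uniform_bits k))"
proof (rule measure_eqI_countable[where A = UNIV])
  fix xss :: "bits list"
  let ?E = "{\<rho> :: nat \<Rightarrow> bool. map (map \<rho>) pss = xss}"
  have "emeasure coin_tape ?E = ennreal (pmf (replicate_pmf (length pss) (uniform_bits k)) xss)"
  proof (cases "map length xss = map length pss")
    case True
    have len: "length xss = length pss" using True by (metis length_map)
    have "length x = k" if "x \<in> set xss" for x
    proof -
      have "length x \<in> set (map length pss)" using that True by (metis image_eqI set_map)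
      then show ?thesis using assms(2) by auto
    qed
    moreover have "length (concat xss) = length (concat pss)"
      by (simp add: length_concat True)
    moreover have "map length pss = replicate (length pss) k"
      using assms(2) by (intro nth_equalityI) auto
    then have "length (concat pss) = length pss * k"
      by (simp add: length_concat sum_list_replicate)
    ultimately show ?thesis
      using emeasure_coin_tape_map[OF assms(1), of "concat xss"]
      by (simp add: map_map_eq_iff_map_concat_eq[OF True] pmf_replicate_pmf len
          prod_list_pmf_uniform_bits)
  next
    case False
    have "?E = {}" using False by (auto simp: comp_def)
    moreover have "length xss \<noteq> length pss \<or> (\<exists>x\<in>set xss. length x \<noteq> k)"
    proof (rule ccontr)
      assume "\<not> ?thesis"
      then have "map length xss = map length pss"
        using assms(2) by (intro nth_equalityI) auto
      with False show False by simp
    qed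
    ultimately show ?thesis
      by (auto simp: pmf_replicate_pmf prod_list_pmf_uniform_bits)
  qed
  moreover have "(\<lambda>\<rho>. map (map \<rho>) pss) -` {xss} \<inter> space coin_tape = ?E" by auto
  ultimately show "emeasure (distr coin_tape (count_space UNIV) (\<lambda>\<rho>. map (map \<rho>) pss)) {xss} =
      emeasure (measure_pmf (replicate_pmf (length pss) (uniform_bits k))) {xss}"
    by (simp add: emeasure_distr measurable_coin_tape_map_map emeasure_pmf_single)
qed auto

text \<open>Change of variables in the first factor, with the attacker's tape left alone.
  Countability of the value type makes \<open>Q\<close> jointly measurable as soon as each
  \<open>Q x\<close> is.\<close>

lemma prob_coin_tape_transfer:
  fixes p :: "'a :: countable pmf"
  assumes "g \<in> measurable coin_tape (count_space UNIV)"
    and "distr coin_tape (count_space UNIV) g = measure_pmf p"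
    and "\<And>x. Measurable.pred coin_tape (Q x)"
  shows "\<P>((\<rho>\<^sub>1, \<rho>\<^sub>2) in coin_tape \<Otimes>\<^sub>M coin_tape. Q (g \<rho>\<^sub>1) \<rho>\<^sub>2) =
         \<P>((x, \<rho>) in measure_pmf p \<Otimes>\<^sub>M coin_tape. Q x \<rho>)"
proof -
  interpret prob_space coin_tape by (rule prob_space_coin_tape)
  let ?C = "count_space UNIV :: 'a measure"
  have meas: "Measurable.pred (?C \<Otimes>\<^sub>M coin_tape) (\<lambda>(x, \<rho>). Q x \<rho>)"
    using measurable_pair_measure_countable1[of UNIV "\<lambda>(x, \<rho>). Q x \<rho>" coin_tape "count_space UNIV"]
      assms(3) by simp
  have pair: "distr (coin_tape \<Otimes>\<^sub>M coin_tape) (?C \<Otimes>\<^sub>M coin_tape) (\<lambda>(x, y). (g x, y)) =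
      measure_pmf p \<Otimes>\<^sub>M coin_tape"
    using pair_measure_distr[OF assms(1) measurable_ident, of coin_tape] assms(2)
      sigma_finite_measure_axioms by (simp add: id_def)
  have gm: "(\<lambda>(x, y). (g x, y)) \<in> measurable (coin_tape \<Otimes>\<^sub>M coin_tape) (?C \<Otimes>\<^sub>M coin_tape)"
    using assms(1) by measurable
  have "{z \<in> space (?C \<Otimes>\<^sub>M coin_tape). (\<lambda>(x, \<rho>). Q x \<rho>) z} \<in> sets (?C \<Otimes>\<^sub>M coin_tape)"
    using meas by measurable
  from measure_distr[OF gm this] show ?thesis
    unfolding pair
    by (simp add: space_pair_measure case_prod_unfold vimage_def)
qed

section \<open>The two acceptance probabilities as CPRNG experiments\<close>

lemma distinct_concat_name_blocks:
  assumes "computational_model \<Sigma> M" and "distinct ns"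
  shows "distinct (concat (map (\<lambda>n. [name_pos M \<eta> n..<name_pos M \<eta> n + \<eta>]) ns))"
  \<comment> \<open>The induction avoids asking for distinct blocks: for \<open>\<eta> = 0\<close>
    all blocks are the same empty list, yet their concatenation is distinct.\<close>
  using assms(2)
proof (induction ns)
  case (Cons n ns)
  have "name_block M \<eta> n \<inter> name_block M \<eta> n' = {}" if "n' \<in> set ns" for n'
    using assms(1) that Cons.prems unfolding computational_model_def by (metis distinct.simps(2))
  then show ?case
    using Cons by (fastforce simp: name_block_def)
qed simp

lemma adv_prob_names:
  assumes "computational_model \<Sigma> M" and "distinct ns"
  shows "adv_prob M A \<eta> (map Name ns) =
    \<P>((rs, \<rho>) in measure_pmf (replicate_pmf (length ns) (uniform_bits \<eta>)) \<Otimes>\<^sub>M coin_tape.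
       accepts A \<eta> rs \<rho>)"
proof -
  define pss where "pss = map (\<lambda>n. [name_pos M \<eta> n..<name_pos M \<eta> n + \<eta>]) ns"
  have "map (eval_term M \<eta> \<rho>) (map Name ns) = map (map \<rho>) pss" for \<rho>
    by (simp add: pss_def)
  moreover have "distinct (concat pss)"
    unfolding pss_def by (rule distinct_concat_name_blocks[OF assms])
  then have "distr coin_tape (count_space UNIV) (\<lambda>\<rho>. map (map \<rho>) pss) =
      measure_pmf (replicate_pmf (length ns) (uniform_bits \<eta>))"
    by (subst distr_coin_tape_blocks[where k = \<eta>]) (auto simp: pss_def)
  ultimately show ?thesis
    unfolding adv_prob_def
    using prob_coin_tape_transfer[where Q = "accepts A \<eta>", OF measurable_coin_tape_map_map _ measurable_accepts]
    by simp
qed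

lemma distr_coin_tape_map:
  assumes "distinct ps"
  shows "distr coin_tape (count_space UNIV) (\<lambda>\<rho>. map \<rho> ps) =
         measure_pmf (uniform_bits (length ps))"
  using assms measurable_coin_tape_map[of ps] emeasure_coin_tape_map[OF assms]
  by (intro measure_eqI_countable[where A = UNIV])
    (auto simp: emeasure_distr emeasure_pmf_single pmf_uniform_bits vimage_def)

lemma eval_prng_term:
  "eval_term M \<eta> \<rho> (prng_term m i) =
     prng_state (fun_int M ProjS) (fun_int M Gen) (fun_int M Init) \<eta> (eval_term M \<eta> \<rho> (Name m)) i"
  by (induction i) simp_all

text \<open>The only name in these terms is \<open>m\<close>, so the honest tape enters through a
  single block, which is the uniform seed \<open>r\<close>.\<close>

lemma adv_prob_prng:
  "adv_prob M A \<eta> (map (\<lambda>i. App ProjO [prng_term m i]) is) =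
    \<P>((r, \<rho>) in measure_pmf (uniform_bits \<eta>) \<Otimes>\<^sub>M coin_tape.
       accepts A \<eta> (map (\<lambda>i. fun_int M ProjO \<eta>
         [prng_state (fun_int M ProjS) (fun_int M Gen) (fun_int M Init) \<eta> r i]) is) \<rho>)"
proof -
  have "distr coin_tape (count_space UNIV) (\<lambda>\<rho>. map \<rho> [name_pos M \<eta> m..<name_pos M \<eta> m + \<eta>]) =
      measure_pmf (uniform_bits \<eta>)"
    using distr_coin_tape_map[of "[name_pos M \<eta> m..<name_pos M \<eta> m + \<eta>]"] by simp
  from prob_coin_tape_transfer[where Q = "\<lambda>r. accepts A \<eta> (map (\<lambda>i. fun_int M ProjO \<eta>
         [prng_state (fun_int M ProjS) (fun_int M Gen) (fun_int M Init) \<eta> r i]) is)",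
      OF measurable_coin_tape_map this measurable_accepts]
  show ?thesis
    by (simp add: adv_prob_def eval_prng_term comp_def)
qed

theorem proposition5:
  fixes \<Sigma> :: "('f, 's) signature"
    and M :: "('n, 'f, 's) model"
    and n :: nat
    and ns :: "'n list"
    and m :: 'n
  assumes "computational_model \<Sigma> M"
    and "cprng (fun_int M ProjS) (fun_int M ProjO) (fun_int M Gen) (fun_int M Init)"
    and "length ns = Suc n"
    and "distinct ns"
  shows "M \<Turnstile> map (\<lambda>i. App ProjO [prng_term m i]) [0..<Suc n] \<sim> map Name ns"
  \<comment> \<open>The two sides are rewritten as separate experiments, so \<open>m\<close> may
    occur among \<open>ns\<close>. \<open>upt_Suc\<close> and \<open>replicate_pmf.simps\<close>
    stay folded so that the goal matches the CPRNG assumption.\<close>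
  using assms(2)
  unfolding indist_def cprng_def adv_prob_prng adv_prob_names[OF assms(1,4)] assms(3)
  by (simp add: assms(3) del: upt_Suc replicate_pmf.simps)

end
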